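(* Let $\{g_t\}_{t\ge1}$ be the family of total Boolean functions $g_t:\{0,1\}^{29^t}\to\{0,1\}$ defined as follows: $g_1(x_1,\ldots,x_{29})=1$ if and only if the Hamming weight of $(x_1,\ldots,x_{29})$ is $13$, $14$, $15$, or $16$; and for $t>1$, $$g_t(x_1,\ldots,x_{29^t})=g_1\left(g_{t-1}(X_1),\ldots,g_{t-1}(X_{29})\right),$$ where $X_1$ is the first block of $29^{t-1}$ input bits, $X_2$ the second block of $29^{t-1}$ input bits, and so on. Then $$RC(g_t)=\Theta\left(C(g_t)^{0.907}\right).$$
   Context: Let $f:\{0,1\}^n\to\{0,1\}$ be a total Boolean function. A certificate for an input $X$ is a set $S\subseteq\{1,\ldots,n\}$ such that for all $Y\in\{0,1\}^n$, if $y_i=x_i$ for all $i\in S$ then $f(Y)=f(X)$. $C^X(f)$ is the minimum size of a certificate for $X$, and $C(f)=\max_X C^X(f)$. A randomized verifier for an input $X$ is a randomized algorithm, accessing its input $Y\in\{0,1\}^n$ only by (possibly adaptive) queries to bits $y_i$, that (i) accepts with probability $1$ if $Y=X$, and (ii) rejects with probability at least $1/2$ if $f(Y)\neq f(X)$ (if $Y\ne X$ but $f(Y)=f(X)$ the acceptance probability can be arbitrary). The algorithm may depend on $X$ and $f$. $RC^X(f)$ is the minimum expected number of queries used by a randomized verifier for $X$, and $RC(f)=\max_X RC^X(f)$.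
   Formalization: The exponent 0.907 is read as a rounded decimal: the formal claim is that RC(g_t) = Θ(C(g_t)^c) for some constant c with |c − 0.907| < 0.0005; with exactly 0.907 the claim fails, since the true exponent is ln 17 / ln((13+√1053)/2) ≈ 0.90707. *)

theory Defs
  imports "HOL-Probability.Probability" "HOL-Library.Landau_Symbols"
begin

text \<open>
  Elements of \<open>{0,1}\<^sup>n\<close> are boolean lists of length \<open>n\<close>, with positions numbered from 0.
  A total Boolean function on \<open>{0,1}\<^sup>n\<close> is a function on boolean lists of which only the
  values on \<open>inputs n\<close> are ever used.
\<close>

definition inputs :: "nat \<Rightarrow> bool list set" where
  "inputs n = {x. length x = n}"

definition is_certificate :: "nat \<Rightarrow> (bool list \<Rightarrow> bool) \<Rightarrow> bool list \<Rightarrow> nat set \<Rightarrow> bool" where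
  "is_certificate n f X S \<longleftrightarrow>
     S \<subseteq> {..<n} \<and> (\<forall>Y\<in>inputs n. (\<forall>i\<in>S. Y ! i = X ! i) \<longrightarrow> f Y = f X)"

definition cert_at :: "nat \<Rightarrow> (bool list \<Rightarrow> bool) \<Rightarrow> bool list \<Rightarrow> nat" where
  "cert_at n f X = Min (card ` {S. is_certificate n f X S})"

definition cert :: "nat \<Rightarrow> (bool list \<Rightarrow> bool) \<Rightarrow> nat" where
  "cert n f = Max (cert_at n f ` inputs n)"

text \<open>
  A deterministic (adaptive) query algorithm is a decision tree; \<open>Query i l r\<close> reads bit \<open>i\<close> and
  continues with \<open>l\<close> if it is 0 and with \<open>r\<close> if it is 1. A randomized query algorithm is a
  probability distribution over decision trees. There are countably many trees, so a \<open>pmf\<close>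
  loses no generality.
\<close>

datatype dtree = Answer bool | Query nat dtree dtree

primrec accepts :: "dtree \<Rightarrow> bool list \<Rightarrow> bool" where
  "accepts (Answer b) Y = b"
| "accepts (Query i l r) Y = (if Y ! i then accepts r Y else accepts l Y)"

primrec num_queries :: "dtree \<Rightarrow> bool list \<Rightarrow> nat" where
  "num_queries (Answer b) Y = 0"
| "num_queries (Query i l r) Y = Suc (if Y ! i then num_queries r Y else num_queries l Y)"

primrec query_positions :: "dtree \<Rightarrow> nat set" where
  "query_positions (Answer b) = {}"
| "query_positions (Query i l r) = insert i (query_positions l \<union> query_positions r)"

definition is_rand_verifier ::
    "nat \<Rightarrow> (bool list \<Rightarrow> bool) \<Rightarrow> bool list \<Rightarrow> dtree pmf \<Rightarrow> bool" where
  "is_rand_verifier n f X A \<longleftrightarrow>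
     (\<forall>T\<in>set_pmf A. query_positions T \<subseteq> {..<n}) \<and>
     measure_pmf.prob A {T. accepts T X} = 1 \<and>
     (\<forall>Y\<in>inputs n. f Y \<noteq> f X \<longrightarrow> measure_pmf.prob A {T. \<not> accepts T Y} \<ge> 1 / 2)"

text \<open>
  The expected number of queries is taken on a worst-case input \<open>Y\<close>. (Taking it on \<open>Y = X\<close>
  gives the same minimum, because a verifier may reject as soon as it reads a bit that disagrees
  with \<open>X\<close>.) The expectation is a nonnegative integral with values in \<open>ennreal\<close>, since the
  Bochner integral would assign cost 0 to a verifier with infinite expected cost.
\<close>

definition expected_queries :: "nat \<Rightarrow> dtree pmf \<Rightarrow> ennreal" where
  "expected_queries n A = (SUP Y\<in>inputs n. \<integral>\<^sup>+ T. of_nat (num_queries T Y) \<partial>measure_pmf A)"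

definition rand_cert_at :: "nat \<Rightarrow> (bool list \<Rightarrow> bool) \<Rightarrow> bool list \<Rightarrow> real" where
  "rand_cert_at n f X = enn2real (INF A\<in>{A. is_rand_verifier n f X A}. expected_queries n A)"

definition rand_cert :: "nat \<Rightarrow> (bool list \<Rightarrow> bool) \<Rightarrow> real" where
  "rand_cert n f = Max (rand_cert_at n f ` inputs n)"

definition g1 :: "bool list \<Rightarrow> bool" where
  "g1 x \<longleftrightarrow> count_list x True \<in> {13, 14, 15, 16}"

definition block :: "nat \<Rightarrow> nat \<Rightarrow> 'a list \<Rightarrow> 'a list" where
  "block m i x = take m (drop (i * m) x)"

text \<open>\<open>g t\<close> is a function on \<open>{0,1}\<close> to the power \<open>29 ^ t\<close> for \<open>t \<ge> 1\<close>; \<open>g 0\<close> is a dummy.\<close>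

fun g :: "nat \<Rightarrow> bool list \<Rightarrow> bool" where
  "g 0 x = undefined"
| "g (Suc 0) x = g1 x"
| "g (Suc (Suc t)) x = g1 (map (\<lambda>i. g (Suc t) (block (29 ^ Suc t) i x)) [0..<29])"

text \<open>
  The exponent 0.907 in the theorem is a value rounded to three decimals: the growth rates are
  \<open>17 ^ t\<close> for \<open>rand_cert\<close> and \<open>((13 + sqrt 1053) / 2) ^ t\<close> for \<open>cert\<close>, and the quotient of
  their logarithms is \<open>0.90707\<dots>\<close>. It is therefore stated as a constant within 0.0005 of 0.907;
  at most one such constant can exist, as \<open>cert (29 ^ t) (g t)\<close> is unbounded in \<open>t\<close>.
\<close>

end

theory Submission
  imports Defs
begin

text \<open>
  Both complexities are multiplicative under composition, up to a constant factor.

  A certificate for \<open>g\<^sub>1 = 1\<close> needs 13 ones and 13 zeros, one for \<open>g\<^sub>1 = 0\<close> needs 17 equal bits.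
  Certificates of a composition split into certificates of its blocks, so the worst-case
  certificate sizes for the two values obey
  \<open>C\<^sub>1(t+1) = 13 C\<^sub>1(t) + 13 C\<^sub>0(t)\<close> and \<open>C\<^sub>0(t+1) = 17 C\<^sub>1(t)\<close>, and grow like \<open>r\<^sup>t\<close> with
  \<open>r\<^sup>2 = 13 r + 221\<close>.

  For every \<open>X\<close> there is a distribution on positions which hits a difference between \<open>X\<close> and any
  \<open>Y\<close> of opposite value with probability at least \<open>17\<^sup>-\<^sup>t\<close>: for \<open>t = 1\<close> by inspection, and in general
  by drawing a block and then a position within that block. Checking \<open>17\<^sup>t\<close> independent samples is
  a verifier. Conversely, some input has \<open>17\<^sup>t\<close> sensitive bits (12 blocks of value 1 and 17 of value
  0), each of which a verifier must query with probability at least \<open>1/2\<close>.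
\<close>

section \<open>Iterated composition and the block structure of inputs\<close>

text \<open>For \<open>t \<ge> 1\<close> this is \<open>g t\<close>, but the recursion starts from a
  single bit instead of a dummy, so every induction has a trivial base case and one uniform
  step.\<close>

primrec iter_g1 :: "nat \<Rightarrow> bool list \<Rightarrow> bool" where
  "iter_g1 0 x = x ! 0"
| "iter_g1 (Suc t) x = g1 (map (\<lambda>i. iter_g1 t (block (29 ^ t) i x)) [0..<29])"

lemma count_list_map_upt:
  "count_list (map P [0..<n]) True = card {i. i < n \<and> P i}"
proof (induction n)
  case (Suc n)
  have "{i. i < Suc n \<and> P i} = (if P n then insert n {i. i < n \<and> P i} else {i. i < n \<and> P i})"
    by (auto simp: less_Suc_eq)
  then show ?case using Suc by simp
qed simp

lemma iter_g1_Suc: "iter_g1 (Suc t) x \<longleftrightarrow> card {i. i < 29 \<and> iter_g1 t (block (29 ^ t) i x)} \<in> {13..16}"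
  by (auto simp: g1_def count_list_map_upt simp del: upt_rec_numeral)

declare iter_g1.simps(2) [simp del]

lemma block_in_inputs: "x \<in> inputs (n * m) \<Longrightarrow> i < n \<Longrightarrow> block m i x \<in> inputs m"
proof -
  assume x: "x \<in> inputs (n * m)" and i: "i < n"
  have "Suc i * m \<le> n * m" using i by (intro mult_right_mono) auto
  then have "m \<le> n * m - i * m" by simp
  then show ?thesis using x by (simp add: inputs_def block_def)
qed

lemma block_index: "i < n \<Longrightarrow> j < m \<Longrightarrow> i * m + j < n * (m::nat)"
proof -
  assume i: "i < n" and j: "j < m"
  have "Suc i * m \<le> n * m" using i by (intro mult_right_mono) auto
  then show ?thesis using j by simp
qed

lemma nth_block: "x \<in> inputs (n * m) \<Longrightarrow> i < n \<Longrightarrow> j < m \<Longrightarrow> block m i x ! j = x ! (i * m + j)"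
  using block_index[of i n j m] by (simp add: inputs_def block_def)

definition join_blocks :: "nat \<Rightarrow> nat \<Rightarrow> (nat \<Rightarrow> bool list) \<Rightarrow> bool list" where
  "join_blocks m n B = map (\<lambda>k. B (k div m) ! (k mod m)) [0..<n * m]"

lemma join_blocks_in_inputs: "join_blocks m n B \<in> inputs (n * m)"
  by (simp add: join_blocks_def inputs_def)

lemma nth_join_blocks:
  "i < n \<Longrightarrow> j < m \<Longrightarrow> join_blocks m n B ! (i * m + j) = B i ! j"
  using block_index[of i n j m] by (simp add: join_blocks_def)

lemma block_join_blocks:
  assumes "i < n" "B i \<in> inputs m"
  shows "block m i (join_blocks m n B) = B i"
proof (rule nth_equalityI)
  show len: "length (block m i (join_blocks m n B)) = length (B i)"
    using block_in_inputs[OF join_blocks_in_inputs, of i n m B] assms by (simp add: inputs_def)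
  show "block m i (join_blocks m n B) ! j = B i ! j" 
    if "j < length (block m i (join_blocks m n B))" for j
    using that assms len nth_block[OF join_blocks_in_inputs, of i n j m B] nth_join_blocks[of i n j m B]
    by (simp add: inputs_def)
qed

lemma iter_g1_join_blocks:
  assumes "\<And>i. i < 29 \<Longrightarrow> B i \<in> inputs (29 ^ t)"
  shows "iter_g1 (Suc t) (join_blocks (29 ^ t) 29 B) \<longleftrightarrow> card {i. i < 29 \<and> iter_g1 t (B i)} \<in> {13..16}"
proof -
  have "{i. i < 29 \<and> iter_g1 t (block (29 ^ t) i (join_blocks (29 ^ t) 29 B))} = {i. i < 29 \<and> iter_g1 t (B i)}"
    using block_join_blocks assms by auto
  then show ?thesis by (simp only: iter_g1_Suc)
qed

lemma g_eq_iter_g1: "x \<in> inputs (29 ^ Suc t) \<Longrightarrow> g (Suc t) x = iter_g1 (Suc t) x"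
proof (induction t arbitrary: x)
  case 0
  \<comment> \<open>At this level the blocks are single bits, and together they give back
    \<open>x\<close>.\<close>
  have "map (\<lambda>i. block (Suc 0) i x ! 0) [0..<29] = x"
    using 0 nth_block[of x 29 1 _ 0]
    by (intro nth_equalityI) (auto simp: inputs_def simp del: upt_rec_numeral)
  then show ?case by (simp add: iter_g1.simps(2) del: upt_rec_numeral)
next
  case (Suc t)
  have "map (\<lambda>i. g (Suc t) (block (29 ^ Suc t) i x)) [0..<29]
      = map (\<lambda>i. iter_g1 (Suc t) (block (29 ^ Suc t) i x)) [0..<29]"
    using Suc.IH block_in_inputs[of x 29 "29 ^ Suc t"] Suc.prems by (intro map_cong) auto
  then show ?case by (simp only: g.simps iter_g1.simps(2))
qed

section \<open>Dependence on the values in \<open>inputs n\<close>, and bounds for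
  \<open>cert\<close>\<close>

text \<open>\<open>g\<close> and \<open>iter_g1\<close> are only known to agree on inputs of the
  right length; this and the congruence lemmas for \<open>cert\<close> and \<open>rand_cert\<close>
  make that sufficient.\<close>

lemma is_certificate_cong:
  assumes "\<And>x. x \<in> inputs n \<Longrightarrow> f x = f' x" "X \<in> inputs n"
  shows "is_certificate n f X S = is_certificate n f' X S"
  using assms by (simp add: is_certificate_def)

lemma cert_cong:
  assumes "\<And>x. x \<in> inputs n \<Longrightarrow> f x = f' x"
  shows "cert n f = cert n f'"
proof -
  have "cert_at n f X = cert_at n f' X" if "X \<in> inputs n" for X
    unfolding cert_at_def using is_certificate_cong[OF assms that] by presburger
  then show ?thesis
    unfolding cert_def by (metis (no_types, lifting) image_cong)
qed

lemma rand_cert_cong: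
  assumes "\<And>x. x \<in> inputs n \<Longrightarrow> f x = f' x"
  shows "rand_cert n f = rand_cert n f'"
proof -
  have "is_rand_verifier n f X A = is_rand_verifier n f' X A" if "X \<in> inputs n" for X A
    using assms that by (simp add: is_rand_verifier_def)
  then have "rand_cert_at n f X = rand_cert_at n f' X" if "X \<in> inputs n" for X
    unfolding rand_cert_at_def using that by presburger
  then show ?thesis
    unfolding rand_cert_def by (metis (no_types, lifting) image_cong)
qed

lemma finite_inputs: "finite (inputs n)"
  using finite_lists_length_eq[of "UNIV :: bool set" n] by (simp add: inputs_def)

lemma inputs_nonempty: "inputs n \<noteq> {}"
  using Ex_list_of_length[of n] by (auto simp: inputs_def)

lemma finite_is_certificate: "finite {S. is_certificate n f X S}"
  by (rule finite_subset[of _ "Pow {..<n}"]) (auto simp: is_certificate_def)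

text \<open>Ensures that the set under \<open>Min\<close> in \<open>cert_at\<close> is never
  empty.\<close>

lemma is_certificate_lessThan:
  assumes "X \<in> inputs n"
  shows "is_certificate n f X {..<n}"
proof -
  have "Y = X" if "Y \<in> inputs n" "\<forall>i\<in>{..<n}. Y ! i = X ! i" for Y
    using that assms by (intro nth_equalityI) (auto simp: inputs_def)
  then show ?thesis by (auto simp: is_certificate_def)
qed

lemma cert_leI:
  assumes "\<And>X. X \<in> inputs n \<Longrightarrow> \<exists>S. is_certificate n f X S \<and> card S \<le> c"
  shows "cert n f \<le> c"
proof -
  have "cert_at n f X \<le> c" if "X \<in> inputs n" for X
  proof -
    obtain S where "is_certificate n f X S" "card S \<le> c" using assms[OF \<open>X \<in> inputs n\<close>] by blast
    then show ?thesis
      unfolding cert_at_def by (intro order_trans[OF Min_le]) (auto intro: finite_is_certificate)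
  qed
  then show ?thesis
    unfolding cert_def using finite_inputs inputs_nonempty by (subst Max_le_iff) auto
qed

lemma cert_geI:
  assumes X: "X \<in> inputs n" and le: "\<And>S. is_certificate n f X S \<Longrightarrow> c \<le> card S"
  shows "c \<le> cert n f"
proof -
  have "c \<le> cert_at n f X"
    unfolding cert_at_def using is_certificate_lessThan[OF X] finite_is_certificate le
    by (subst Min_ge_iff) auto
  also have "\<dots> \<le> cert n f"
    unfolding cert_def using X finite_inputs by (intro Max_ge) auto
  finally show ?thesis .
qed

section \<open>Certificate complexity\<close>

definition slice :: "nat \<Rightarrow> nat \<Rightarrow> nat set \<Rightarrow> nat set" where
  "slice m i S = {j. j < m \<and> i * m + j \<in> S}"

text \<open>Shifted back to positions of the whole input, the slices are pairwise disjoint parts of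
  \<open>S\<close>, because \<open>div m\<close> recovers the block from a position. For infinite
  \<open>D\<close> the sum is 0 by convention.\<close>

lemma sum_card_slice_le:
  assumes S: "finite S"
  shows "(\<Sum>i\<in>D. card (slice m i S)) \<le> card S"
proof (cases "finite D")
  case True
  let ?A = "\<lambda>i. (\<lambda>j. i * m + j) ` slice m i S"
  have "(\<Sum>i\<in>D. card (slice m i S)) = (\<Sum>i\<in>D. card (?A i))"
    by (intro sum.cong refl card_image[symmetric] inj_onI) auto
  also have "\<dots> = card (\<Union>i\<in>D. ?A i)"
  proof (rule card_UN_disjoint[symmetric])
    have "k div m = i" if "k \<in> ?A i" for k i
      using that by (auto simp: slice_def)
    then show "\<forall>i\<in>D. \<forall>j\<in>D. i \<noteq> j \<longrightarrow> ?A i \<inter> ?A j = {}"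
      by (metis disjoint_iff)
  qed (use True in \<open>auto simp: slice_def\<close>)
  also have "\<dots> \<le> card S"
    using S by (intro card_mono) (auto simp: slice_def)
  finally show ?thesis .
qed simp

text \<open>The union of the shifted sets \<open>S i\<close> fixes the value of every block in
  \<open>I\<close>. By \<open>force\<close> these values decide the outer value, whatever the
  remaining blocks do.\<close>

lemma certificate_from_blocks:
  assumes X: "X \<in> inputs (29 * 29 ^ t)" and I: "I \<subseteq> {..<29}"
    and cert: "\<And>i. i \<in> I \<Longrightarrow> is_certificate (29 ^ t) (iter_g1 t) (block (29 ^ t) i X) (S i)"
    and force: "\<And>P. (\<And>i. i \<in> I \<Longrightarrow> P i = iter_g1 t (block (29 ^ t) i X)) \<Longrightarrow>
                 (card {i. i < 29 \<and> P i} \<in> {13..16}) = iter_g1 (Suc t) X"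
  shows "\<exists>S'. is_certificate (29 ^ Suc t) (iter_g1 (Suc t)) X S' \<and> card S' \<le> (\<Sum>i\<in>I. card (S i))"
proof (intro exI conjI)
  let ?m = "29 ^ t :: nat"
  let ?S = "\<Union>i\<in>I. (\<lambda>j. i * ?m + j) ` S i"
  have fin: "finite I" using I finite_subset by blast
  have sub: "S i \<subseteq> {..<?m}" if "i \<in> I" for i
    using cert[OF that] by (simp add: is_certificate_def)
  show "is_certificate (29 ^ Suc t) (iter_g1 (Suc t)) X ?S"
    unfolding is_certificate_def
  proof (intro conjI ballI impI)
    show "?S \<subseteq> {..<29 ^ Suc t}"
    proof
      fix k assume "k \<in> ?S"
      then obtain i j where ij: "i \<in> I" "j \<in> S i" "k = i * ?m + j" by blast
      then have "i < 29" "j < ?m" using sub I by auto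
      then show "k \<in> {..<29 ^ Suc t}" using block_index[of i 29 j ?m] ij(3) by simp
    qed
  next
    fix Y assume "Y \<in> inputs (29 ^ Suc t)" and agree: "\<forall>i\<in>?S. Y ! i = X ! i"
    then have Y: "Y \<in> inputs (29 * ?m)" by simp
    have "iter_g1 t (block ?m i Y) = iter_g1 t (block ?m i X)" if i: "i \<in> I" for i
    proof -
      have i29: "i < 29" using i I by auto
      have "\<forall>j\<in>S i. block ?m i Y ! j = block ?m i X ! j"
        using agree i sub[OF i] nth_block[OF X i29] nth_block[OF Y i29] by auto
      then show ?thesis
        using cert[OF i] block_in_inputs[OF Y i29] by (auto simp: is_certificate_def)
    qed
    from force[of "\<lambda>i. iter_g1 t (block ?m i Y)", OF this]
    show "iter_g1 (Suc t) Y = iter_g1 (Suc t) X" by (simp only: iter_g1_Suc)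
  qed
  have "card ?S \<le> (\<Sum>i\<in>I. card ((\<lambda>j. i * ?m + j) ` S i))"
    by (rule card_UN_le[OF fin])
  also have "\<dots> \<le> (\<Sum>i\<in>I. card (S i))"
    by (intro sum_mono card_image_le) (meson sub finite_subset finite_lessThan)
  finally show "card ?S \<le> (\<Sum>i\<in>I. card (S i))" .
qed

text \<open>Blocks whose slice of \<open>S\<close> is not a certificate can be given the opposite value, independently
  of each other, without disturbing the bits in \<open>S\<close>.\<close>

lemma certificate_slice_forced:
  assumes X: "X \<in> inputs (29 * 29 ^ t)"
    and S: "is_certificate (29 ^ Suc t) (iter_g1 (Suc t)) X S"
    and E: "\<And>i. i \<in> E \<Longrightarrow> i < 29 \<and>
      \<not> is_certificate (29 ^ t) (iter_g1 t) (block (29 ^ t) i X) (slice (29 ^ t) i S)"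
  shows "(card {i. i < 29 \<and> (iter_g1 t (block (29 ^ t) i X) \<noteq> (i \<in> E))} \<in> {13..16})
           = iter_g1 (Suc t) X"
proof -
  let ?m = "29 ^ t :: nat"
  have "\<exists>Z. Z \<in> inputs ?m \<and> (\<forall>j\<in>slice ?m i S. Z ! j = block ?m i X ! j) \<and>
          iter_g1 t Z \<noteq> iter_g1 t (block ?m i X)" if "i \<in> E" for i
    using E[OF that] by (auto simp: is_certificate_def slice_def)
  then obtain Z where Z: "\<And>i. i \<in> E \<Longrightarrow> Z i \<in> inputs ?m"
    "\<And>i j. i \<in> E \<Longrightarrow> j \<in> slice ?m i S \<Longrightarrow> Z i ! j = block ?m i X ! j"
    "\<And>i. i \<in> E \<Longrightarrow> iter_g1 t (Z i) \<noteq> iter_g1 t (block ?m i X)"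
    by metis
  \<comment> \<open>Exactly the blocks in \<open>E\<close> change their value, and all bits in
    \<open>S\<close> stay as in \<open>X\<close>.\<close>
  define B where "B i = (if i \<in> E then Z i else block ?m i X)" for i
  let ?Y = "join_blocks ?m 29 B"
  have B: "B i \<in> inputs ?m" if "i < 29" for i
    using Z(1) block_in_inputs[OF X that] by (simp add: B_def)
  have agree: "?Y ! k = X ! k" if k: "k \<in> S" for k
  proof -
    have "k < 29 * ?m" using S k by (auto simp: is_certificate_def)
    then have ij: "k div ?m < 29" "k mod ?m < ?m"
      by (auto simp: less_mult_imp_div_less)
    have eq: "k div ?m * ?m + k mod ?m = k" by (rule div_mult_mod_eq)
    have "?Y ! k = B (k div ?m) ! (k mod ?m)"
      using nth_join_blocks[OF ij, of B] by (simp only: eq)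
    also have "\<dots> = block ?m (k div ?m) X ! (k mod ?m)"
    proof (cases "k div ?m \<in> E")
      case True
      have "k mod ?m \<in> slice ?m (k div ?m) S" using k ij by (simp only: slice_def eq mem_Collect_eq)
      then show ?thesis using Z(2)[OF True] True by (simp add: B_def)
    qed (simp add: B_def)
    also have "\<dots> = X ! k"
      using nth_block[OF X ij] by (simp only: eq)
    finally show ?thesis .
  qed
  have "?Y \<in> inputs (29 ^ Suc t)" using join_blocks_in_inputs[of ?m 29 B] by simp
  then have "iter_g1 (Suc t) ?Y = iter_g1 (Suc t) X"
    using S agree by (simp only: is_certificate_def) blast
  \<comment> \<open>Here \<open>\<noteq>\<close> against \<open>i \<in> E\<close> acts as exclusive
    or: membership in \<open>E\<close> flips the value.\<close>
  moreover have "{i. i < 29 \<and> iter_g1 t (B i)}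
      = {i. i < 29 \<and> (iter_g1 t (block (29 ^ t) i X) \<noteq> (i \<in> E))}"
    using Z(3) by (auto simp: B_def)
  ultimately show ?thesis using iter_g1_join_blocks[of B t, OF B] by simp
qed

section \<open>Worst-case certificate sizes\<close>

text \<open>These are \<open>C\<^sub>1\<close> for \<open>True\<close> and \<open>C\<^sub>0\<close>
  for \<open>False\<close>. The equation for \<open>False\<close> charges 17 blocks of value 1
  because blocks of value 1 are the dearer ones.\<close>

fun cert_rec :: "bool \<Rightarrow> nat \<Rightarrow> nat" where
  "cert_rec b 0 = 1"
| "cert_rec True (Suc t) = 13 * cert_rec True t + 13 * cert_rec False t"
| "cert_rec False (Suc t) = 17 * cert_rec True t"

lemma cert_rec_False_le: "cert_rec False t \<le> cert_rec True t"
proof -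
  \<comment> \<open>The second inequality strengthens the induction: it is what the first one needs
    at \<open>Suc t\<close>, and it follows there from the first.\<close>
  have "cert_rec False t \<le> cert_rec True t \<and> 4 * cert_rec True t \<le> 13 * cert_rec False t"
    by (induction t) auto
  then show ?thesis by simp
qed

lemma card_lt_split: "card {i. i < 29 \<and> P i} + card {i. i < (29::nat) \<and> \<not> P i} = 29"
proof -
  have "card {i. i < 29 \<and> P i} + card {i. i < 29 \<and> \<not> P i}
      = card ({i. i < 29 \<and> P i} \<union> {i. i < 29 \<and> \<not> P i})"
    by (intro card_Un_disjoint[symmetric]) auto
  also have "{i. i < 29 \<and> P i} \<union> {i. i < 29 \<and> \<not> P i} = {..<29}" by auto
  finally show ?thesis by simp
qed

text \<open>Thirteen blocks of each value keep the number of ones between 13 and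
  \<open>29 - 13 = 16\<close>; 17 zeros keep it at most 12, and 17 ones at least 17. It is enough to
  certify those blocks.\<close>

lemma iter_g1_certificate:
  assumes "X \<in> inputs (29 ^ t)"
  shows "\<exists>S. is_certificate (29 ^ t) (iter_g1 t) X S \<and> card S \<le> cert_rec (iter_g1 t X) t"
  using assms
proof (induction t arbitrary: X)
  case 0
  then show ?case by (intro exI[of _ "{0}"]) (auto simp: is_certificate_def)
next
  case (Suc t)
  let ?m = "29 ^ t :: nat"
  have X: "X \<in> inputs (29 * ?m)" using Suc.prems by simp
  define v where "v i = iter_g1 t (block ?m i X)" for i
  define T where "T = {i. i < 29 \<and> v i}"
  define F where "F = {i. i < 29 \<and> \<not> v i}"
  have TF: "card T + card F = 29" unfolding T_def F_def by (rule card_lt_split)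
  have fin [simp]: "finite T" "finite F" by (auto simp: T_def F_def)
  have val: "iter_g1 (Suc t) X \<longleftrightarrow> card T \<in> {13..16}"
    by (simp only: iter_g1_Suc T_def v_def)
  have "\<exists>S. is_certificate ?m (iter_g1 t) (block ?m i X) S \<and> card S \<le> cert_rec (v i) t" if "i < 29" for i
    unfolding v_def using Suc.IH block_in_inputs[OF X that] .
  then obtain S where S: "\<And>i. i < 29 \<Longrightarrow> is_certificate ?m (iter_g1 t) (block ?m i X) (S i)"
    "\<And>i. i < 29 \<Longrightarrow> card (S i) \<le> cert_rec (v i) t"
    by metis
  \<comment> \<open>Each case only has to name a set \<open>I\<close> of blocks whose values force
    the outer value and whose total cost fits.\<close>
  have main: ?case
    if I: "I \<subseteq> {..<29}" and c: "(\<Sum>i\<in>I. cert_rec (v i) t) \<le> cert_rec (iter_g1 (Suc t) X) (Suc t)"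
      and force: "\<And>P. (\<And>i. i \<in> I \<Longrightarrow> P i = v i) \<Longrightarrow>
                 (card {i. i < 29 \<and> P i} \<in> {13..16}) = iter_g1 (Suc t) X" for I
  proof -
    have "(\<Sum>i\<in>I. card (S i)) \<le> (\<Sum>i\<in>I. cert_rec (v i) t)"
      using I S(2) by (intro sum_mono) auto
    moreover obtain S' where "is_certificate (29 ^ Suc t) (iter_g1 (Suc t)) X S'"
      "card S' \<le> (\<Sum>i\<in>I. card (S i))"
      using certificate_from_blocks[OF X I, of S] S(1) I force unfolding v_def by blast
    ultimately show ?thesis using c by (meson order_trans)
  qed
  have cardP: "card A \<le> card {i. i < 29 \<and> P i}" if "A \<subseteq> {..<29}" "\<And>i. i \<in> A \<Longrightarrow> P i"
    for A and P :: "nat \<Rightarrow> bool"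
    using that by (intro card_mono) auto
  consider (one) "card T \<in> {13..16}" | (low) "card T \<le> 12" | (high) "card T \<ge> 17" by fastforce
  then show ?case
  proof cases
    case one
    have "13 \<le> card T" using one by simp
    then obtain T' where T': "T' \<subseteq> T" "card T' = 13"
      by (rule obtain_subset_with_card_n)
    have "13 \<le> card F" using one TF by simp
    then obtain F' where F': "F' \<subseteq> F" "card F' = 13"
      by (rule obtain_subset_with_card_n)
    have disj: "T' \<inter> F' = {}" using T' F' by (auto simp: T_def F_def)
    have "(\<Sum>i\<in>T'. cert_rec (v i) t) = 13 * cert_rec True t"
      using T' by (subst sum.cong[where h = "\<lambda>_. cert_rec True t"]) (auto simp: T_def)
    moreover have "(\<Sum>i\<in>F'. cert_rec (v i) t) = 13 * cert_rec False t"
      using F' by (subst sum.cong[where h = "\<lambda>_. cert_rec False t"]) (auto simp: F_def)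
    ultimately have s: "(\<Sum>i\<in>T' \<union> F'. cert_rec (v i) t) = cert_rec True (Suc t)"
      using disj T' F' fin by (subst sum.union_disjoint) (auto intro: finite_subset)
    show ?thesis
    proof (rule main[of "T' \<union> F'"])
      show "T' \<union> F' \<subseteq> {..<29}" using T' F' by (auto simp: T_def F_def)
      show "(\<Sum>i\<in>T' \<union> F'. cert_rec (v i) t) \<le> cert_rec (iter_g1 (Suc t) X) (Suc t)"
        using s val one by simp
      fix P assume "\<And>i. i \<in> T' \<union> F' \<Longrightarrow> P i = v i"
      then have "13 \<le> card {i. i < 29 \<and> P i}" "13 \<le> card {i. i < 29 \<and> \<not> P i}"
        using cardP[of T' P] cardP[of F' "\<lambda>i. \<not> P i"] T' F' by (auto simp: T_def F_def)
      with card_lt_split[of P] show "(card {i. i < 29 \<and> P i} \<in> {13..16}) = iter_g1 (Suc t) X"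
        using val one by simp
    qed
  next
    case low
    have "17 \<le> card F" using low TF by simp
    then obtain F' where F': "F' \<subseteq> F" "card F' = 17"
      by (rule obtain_subset_with_card_n)
    show ?thesis
    proof (rule main[of F'])
      show "F' \<subseteq> {..<29}" using F' by (auto simp: F_def)
      have "(\<Sum>i\<in>F'. cert_rec (v i) t) = 17 * cert_rec False t"
        using F' by (subst sum.cong[where h = "\<lambda>_. cert_rec False t"]) (auto simp: F_def)
      \<comment> \<open>Blocks of value 0 cost no more than blocks of value 1, so this case stays
        below \<open>17 * cert_rec True t\<close>.\<close>
      then show "(\<Sum>i\<in>F'. cert_rec (v i) t) \<le> cert_rec (iter_g1 (Suc t) X) (Suc t)"
        using val low cert_rec_False_le[of t] by simp
      fix P assume "\<And>i. i \<in> F' \<Longrightarrow> P i = v i"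
      then have "17 \<le> card {i. i < 29 \<and> \<not> P i}"
        using cardP[of F' "\<lambda>i. \<not> P i"] F' by (auto simp: F_def)
      with card_lt_split[of P] show "(card {i. i < 29 \<and> P i} \<in> {13..16}) = iter_g1 (Suc t) X"
        using val low by simp
    qed
  next
    case high
    have "17 \<le> card T" using high by simp
    then obtain T' where T': "T' \<subseteq> T" "card T' = 17"
      by (rule obtain_subset_with_card_n)
    show ?thesis
    proof (rule main[of T'])
      show "T' \<subseteq> {..<29}" using T' by (auto simp: T_def)
      have "(\<Sum>i\<in>T'. cert_rec (v i) t) = 17 * cert_rec True t"
        using T' by (subst sum.cong[where h = "\<lambda>_. cert_rec True t"]) (auto simp: T_def)
      then show "(\<Sum>i\<in>T'. cert_rec (v i) t) \<le> cert_rec (iter_g1 (Suc t) X) (Suc t)"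
        using val high by simp
      fix P assume "\<And>i. i \<in> T' \<Longrightarrow> P i = v i"
      then have "17 \<le> card {i. i < 29 \<and> P i}"
        using cardP[of T' P] T' by (auto simp: T_def)
      with card_lt_split[of P] show "(card {i. i < 29 \<and> P i} \<in> {13..16}) = iter_g1 (Suc t) X"
        using val high by simp
    qed
  qed
qed

text \<open>Hard inputs of both values are assembled into hard inputs of the next level: 13 blocks
  of value 1 and 16 of value 0 for \<open>b = True\<close>, 29 blocks of value 1 for
  \<open>b = False\<close>. If too few blocks are certified, flipping uncertified ones changes the
  outer value.\<close>

lemma iter_g1_hard_input:
  "\<exists>X\<in>inputs (29 ^ t). iter_g1 t X = b \<and>
     (\<forall>S. is_certificate (29 ^ t) (iter_g1 t) X S \<longrightarrow> cert_rec b t \<le> card S)"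
proof (induction t arbitrary: b)
  case 0
  have "1 \<le> card S" if S: "is_certificate 1 (iter_g1 0) [b] S" for S
  proof -
    have "[\<not> b] \<in> inputs 1" by (simp add: inputs_def)
    then have "S \<noteq> {}" using S by (auto simp: is_certificate_def)
    moreover have "finite S" using S by (auto simp: is_certificate_def intro: finite_subset)
    ultimately show ?thesis by (simp add: Suc_le_eq card_gt_0_iff)
  qed
  moreover have "iter_g1 0 [b] = b" by simp
  ultimately show ?case
    by (intro bexI[of _ "[b]"]) (auto simp: inputs_def simp del: iter_g1.simps)
next
  case (Suc t)
  let ?m = "29 ^ t :: nat"
  obtain W where W: "\<And>b. W b \<in> inputs ?m" "\<And>b. iter_g1 t (W b) = b"
    "\<And>b S. is_certificate ?m (iter_g1 t) (W b) S \<Longrightarrow> cert_rec b t \<le> card S"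
    using Suc.IH by metis
  define v where "v i \<longleftrightarrow> b \<longrightarrow> i < 13" for i :: nat
  define X where "X = join_blocks ?m 29 (\<lambda>i. W (v i))"
  have X: "X \<in> inputs (29 * ?m)" by (simp only: X_def join_blocks_in_inputs)
  have blk: "block ?m i X = W (v i)" if "i < 29" for i
    unfolding X_def using that W(1) by (rule block_join_blocks)
  have v1: "{i. i < 29 \<and> v i} = (if b then {..<13} else {..<29})" by (auto simp: v_def)
  have val: "iter_g1 (Suc t) X = b"
    unfolding X_def by (subst iter_g1_join_blocks) (auto simp: W v1)
  have "cert_rec b (Suc t) \<le> card S" if S: "is_certificate (29 ^ Suc t) (iter_g1 (Suc t)) X S" for S
  proof -
    have finS: "finite S" using S by (auto simp: is_certificate_def intro: finite_subset)
    \<comment> \<open>The blocks certified by their slice of \<open>S\<close>; all others may be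
      flipped freely.\<close>
    define D where "D = {i. i < 29 \<and> is_certificate ?m (iter_g1 t) (block ?m i X) (slice ?m i S)}"
    have forced: "(card {i. i < 29 \<and> (v i \<noteq> (i \<in> E))} \<in> {13..16}) = b" if "E \<subseteq> {..<29} - D" for E
    proof -
      have "{i. i < 29 \<and> (iter_g1 t (block ?m i X) \<noteq> (i \<in> E))} = {i. i < 29 \<and> (v i \<noteq> (i \<in> E))}"
        using blk W(2) by auto
      then show ?thesis
        using certificate_slice_forced[OF X S, of E] that val by (auto simp: D_def)
    qed
    have sum: "(\<Sum>i\<in>D'. cert_rec (v i) t) \<le> card S" if "D' \<subseteq> D" for D'
    proof -
      have "(\<Sum>i\<in>D'. cert_rec (v i) t) \<le> (\<Sum>i\<in>D'. card (slice ?m i S))"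
        using W(3) blk that by (intro sum_mono) (auto simp: D_def)
      also have "\<dots> \<le> card S" by (rule sum_card_slice_le[OF finS])
      finally show ?thesis .
    qed
    have finD: "finite D" by (simp add: D_def)
    show ?thesis
    proof (cases b)
      case True
      let ?T = "{i \<in> D. i < 13}" and ?F = "{i \<in> D. \<not> i < 13}"
      \<comment> \<open>Once every uncertified block of value 1 is flipped, only the certified ones
        still count, so there must be at least 13 of them.\<close>
      have "{i. i < 29 \<and> (v i \<noteq> (i \<in> {..<13} - D))} = ?T"
        using True by (auto simp: v_def D_def)
      moreover have "{..<13} - D \<subseteq> {..<29} - D" by auto
      ultimately have "(card ?T \<in> {13..16}) = b" using forced[of "{..<13} - D"] by simp
      then have T: "13 \<le> card ?T" using True by simp
      \<comment> \<open>Once every uncertified block of value 0 is flipped, the only zeros left are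
        certified; fewer than 13 would mean more than 16 ones.\<close>
      have "{i. i < 29 \<and> (v i \<noteq> (i \<in> {13..<29} - D))} = {..<29} - ?F"
        using True by (auto simp: v_def D_def)
      moreover have "card ({..<29} - ?F) = 29 - card ?F"
        using finD by (subst card_Diff_subset) (auto simp: D_def)
      moreover have "{13..<29} - D \<subseteq> {..<29} - D" by auto
      ultimately have "(29 - card ?F \<in> {13..16}) = b" using forced[of "{13..<29} - D"] by simp
      then have F: "13 \<le> card ?F" using True by auto
      have "cert_rec b (Suc t) \<le> card ?T * cert_rec True t + card ?F * cert_rec False t"
        using T F True by (auto intro!: add_mono mult_right_mono)
      also have "card ?T * cert_rec True t = (\<Sum>i\<in>?T. cert_rec (v i) t)"
        using True by (subst sum.cong[where h = "\<lambda>_. cert_rec True t"]) (auto simp: v_def)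
      also have "card ?F * cert_rec False t = (\<Sum>i\<in>?F. cert_rec (v i) t)"
        using True by (subst sum.cong[where h = "\<lambda>_. cert_rec False t"]) (auto simp: v_def)
      also have "(\<Sum>i\<in>?T. cert_rec (v i) t) + (\<Sum>i\<in>?F. cert_rec (v i) t)
          = (\<Sum>i\<in>?T \<union> ?F. cert_rec (v i) t)"
        using finD by (intro sum.union_disjoint[symmetric]) auto
      also have "\<dots> \<le> card S" by (rule sum) auto
      finally show ?thesis .
    next
      case False
      \<comment> \<open>With at most 16 certified blocks, 13 others can be flipped, which lowers the
        count from 29 to 16 and changes the value.\<close>
      have "17 \<le> card D"
      proof (rule ccontr)
        assume "\<not> 17 \<le> card D"
        moreover have "card ({..<29} - D) = 29 - card D"
          using finD by (subst card_Diff_subset) (auto simp: D_def)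
        ultimately have "13 \<le> card ({..<29} - D)" by simp
        then obtain E where E: "E \<subseteq> {..<29} - D" "card E = 13" "finite E"
          by (rule obtain_subset_with_card_n)
        have "{i. i < 29 \<and> (v i \<noteq> (i \<in> E))} = {..<29} - E" using False by (auto simp: v_def)
        moreover have "card ({..<29} - E) = 16"
          using E by (subst card_Diff_subset) auto
        ultimately show False using forced[OF E(1)] False by simp
      qed
      then have "cert_rec b (Suc t) \<le> card D * cert_rec True t"
        using False by simp
      also have "\<dots> = (\<Sum>i\<in>D. cert_rec (v i) t)"
        using False by (simp add: v_def)
      also have "\<dots> \<le> card S" by (rule sum) auto
      finally show ?thesis .
    qed
  qed
  then show ?case using X val by (intro bexI[of _ X]) auto
qed

lemma cert_iter_g1: "cert (29 ^ t) (iter_g1 t) = cert_rec True t"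
proof (rule antisym)
  have "cert_rec b t \<le> cert_rec True t" for b
    using cert_rec_False_le by (cases b) auto
  then show "cert (29 ^ t) (iter_g1 t) \<le> cert_rec True t"
    using iter_g1_certificate by (intro cert_leI) (meson order_trans)
  obtain X where X: "X \<in> inputs (29 ^ t)"
    "\<And>S. is_certificate (29 ^ t) (iter_g1 t) X S \<Longrightarrow> cert_rec True t \<le> card S"
    using iter_g1_hard_input[of t True] by blast
  show "cert_rec True t \<le> cert (29 ^ t) (iter_g1 t)" by (rule cert_geI[OF X])
qed

section \<open>Growth rate of the certificate complexity\<close>

text \<open>The pair \<open>(1, 17 / r)\<close> is an eigenvector of the recursion for the
  eigenvalue \<open>r\<close>, the positive root of \<open>x^2 = 13 x + 221\<close>. As
  \<open>17 \<le> r\<close>, the initial pair \<open>(1, 1)\<close> lies between it and its multiple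
  \<open>(r / 17, 1)\<close>, and the recursion is monotone.\<close>

lemma cert_rec_bounds:
  fixes r :: real
  assumes r: "r = (13 + sqrt 1053) / 2"
  shows "r ^ t \<le> cert_rec True t" "real (cert_rec True t) \<le> r / 17 * r ^ t"
proof -
  have "32 \<le> sqrt 1053" by (intro real_le_rsqrt) simp
  then have r17: "17 \<le> r" using r by simp
  have sq: "r ^ 2 = 13 * r + 221"
    unfolding r by (simp add: power2_eq_square field_simps)
  have "r ^ t \<le> cert_rec True t \<and> 17 / r * r ^ t \<le> cert_rec False t \<and>
        real (cert_rec True t) \<le> r / 17 * r ^ t \<and> real (cert_rec False t) \<le> r ^ t"
  proof (induction t)
    case (Suc t)
    define a where "a = r ^ t"
    define b where "b = 17 / r * a"
    define d where "d = r / 17 * a"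
    have low: "r * a = 13 * a + 13 * b"
    proof -
      have "r * a * r = r ^ 2 * a" by (simp add: power2_eq_square)
      also have "\<dots> = (13 * a + 13 * b) * r" using r17 by (simp add: sq b_def field_simps)
      finally show ?thesis using r17 by simp
    qed
    have high: "r / 17 * (r * a) = 13 * d + 13 * a"
    proof -
      have "r / 17 * (r * a) = r ^ 2 / 17 * a" by (simp add: power2_eq_square)
      then show ?thesis by (simp add: sq d_def field_simps)
    qed
    have "17 / r * (r * a) = 17 * a" "r * a = 17 * d" using r17 by (auto simp: d_def)
    moreover have "a \<le> cert_rec True t" "b \<le> cert_rec False t"
      "cert_rec True t \<le> d" "cert_rec False t \<le> a"
      using Suc by (auto simp: a_def b_def d_def)
    moreover have "r ^ Suc t = r * a" by (simp add: a_def)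
    ultimately show ?case using low high by (simp only: cert_rec.simps) (intro conjI; linarith)
  qed (use r17 in auto)
  then show "r ^ t \<le> cert_rec True t" "real (cert_rec True t) \<le> r / 17 * r ^ t" by auto
qed

section \<open>Randomized certificate complexity\<close>

text \<open>Only the positions on the path taken by \<open>Y\<close>, whereas
  \<open>query_positions\<close> collects all branches; repeated queries count once.\<close>

primrec queried :: "dtree \<Rightarrow> bool list \<Rightarrow> nat set" where
  "queried (Answer b) Y = {}"
| "queried (Query i l r) Y = insert i (if Y ! i then queried r Y else queried l Y)"

lemma finite_queried: "finite (queried T Y)"
  by (induction T) auto

lemma card_queried_le: "card (queried T Y) \<le> num_queries T Y"
proof (induction T)
  case (Query i l r)
  then show ?case
    using card_insert_le_m1 by (auto simp: card_insert_if finite_queried le_Suc_eq)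
qed simp

lemma accepts_eq_if_agree_on_queried:
  "(\<And>i. i \<in> queried T X \<Longrightarrow> Y ! i = X ! i) \<Longrightarrow> accepts T Y = accepts T X"
  by (induction T) (auto split: if_splits)

text \<open>\<open>A\<close> accepts \<open>X\<close> almost surely, but rejects \<open>X\<close>
  with bit \<open>i\<close> flipped with probability at least 1/2, and a tree that tells the two
  apart reads bit \<open>i\<close> on \<open>X\<close>. Linearity of expectation adds these
  probabilities over \<open>K\<close>.\<close>

lemma expected_queries_ge:
  assumes A: "is_rand_verifier n f X A" and X: "X \<in> inputs n" and K: "K \<subseteq> {..<n}"
    and sens: "\<And>i. i \<in> K \<Longrightarrow> f (X[i := \<not> X ! i]) \<noteq> f X"
  shows "ennreal (card K / 2) \<le> expected_queries n A"
proof -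
  have finK: "finite K" using K finite_subset by blast
  have half: "ennreal (1 / 2) \<le> emeasure A {T. i \<in> queried T X}" if i: "i \<in> K" for i
  proof -
    let ?Y = "X[i := \<not> X ! i]"
    have acc: "AE T in measure_pmf A. accepts T X"
      using A measure_pmf.prob_Collect_eq_1[of A "\<lambda>T. accepts T X"]
      by (auto simp: is_rand_verifier_def)
    have "?Y \<in> inputs n" using X by (simp add: inputs_def)
    then have "1 / 2 \<le> measure_pmf.prob A {T. \<not> accepts T ?Y}"
      using A sens[OF i] by (simp add: is_rand_verifier_def)
    also have "\<dots> \<le> measure_pmf.prob A {T. i \<in> queried T X}"
    proof (rule measure_pmf.finite_measure_mono_AE)
      have step: "i \<in> queried T X" if acc: "accepts T X" "\<not> accepts T ?Y" for T
      proof (rule ccontr)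
        assume "i \<notin> queried T X"
        then have "?Y ! j = X ! j" if "j \<in> queried T X" for j
          using that by (metis nth_list_update_neq)
        from accepts_eq_if_agree_on_queried[OF this] show False using acc by simp
      qed
      show "AE T in measure_pmf A. T \<in> {T. \<not> accepts T ?Y} \<longrightarrow> T \<in> {T. i \<in> queried T X}"
        using acc by eventually_elim (use step in auto)
    qed simp
    finally show ?thesis
      unfolding measure_pmf.emeasure_eq_measure by (rule ennreal_leI)
  qed
  have "ennreal (card K / 2) = (\<Sum>i\<in>K. ennreal (1 / 2))"
    by (subst sum_ennreal) auto
  also have "\<dots> \<le> (\<Sum>i\<in>K. emeasure A {T. i \<in> queried T X})"
    using half by (rule sum_mono)
  also have "\<dots> = (\<Sum>i\<in>K. \<integral>\<^sup>+ T. indicator {T. i \<in> queried T X} T \<partial>measure_pmf A)"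
    by simp
  also have "\<dots> = (\<integral>\<^sup>+ T. (\<Sum>i\<in>K. indicator {T. i \<in> queried T X} T) \<partial>measure_pmf A)"
    by (rule nn_integral_sum[symmetric]) simp
  also have "\<dots> \<le> (\<integral>\<^sup>+ T. of_nat (num_queries T X) \<partial>measure_pmf A)"
  proof (rule nn_integral_mono)
    fix T
    have "(\<Sum>i\<in>K. indicator {T. i \<in> queried T X} T) = (of_nat (card (K \<inter> queried T X)) :: ennreal)"
      using finK by (simp add: indicator_def sum.If_cases Int_def)
    also have "\<dots> \<le> of_nat (num_queries T X)"
      using card_mono[OF finite_queried, of "K \<inter> queried T X" T X] card_queried_le[of T X]
      by (intro of_nat_mono) auto
    finally show "(\<Sum>i\<in>K. indicator {T. i \<in> queried T X} T) \<le> (of_nat (num_queries T X) :: ennreal)" .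
  qed
  also have "\<dots> \<le> expected_queries n A"
    unfolding expected_queries_def using X by (intro SUP_upper)
  finally show ?thesis .
qed

section \<open>Upper bound by checking random positions\<close>

primrec check_positions :: "bool list \<Rightarrow> nat list \<Rightarrow> dtree" where
  "check_positions X [] = Answer True"
| "check_positions X (i # is) =
     (if X ! i then Query i (Answer False) (check_positions X is)
      else Query i (check_positions X is) (Answer False))"

lemma accepts_check_positions:
  "accepts (check_positions X is) Y \<longleftrightarrow> (\<forall>i\<in>set is. Y ! i = X ! i)"
  by (induction "is") auto

lemma num_queries_check_positions: "num_queries (check_positions X is) Y \<le> length is"
  by (induction "is") auto

lemma query_positions_check_positions: "query_positions (check_positions X is) = set is"
  by (induction "is") auto

lemma prob_bind_pmf:
  "measure_pmf.prob (bind_pmf p q) D = measure_pmf.expectation p (\<lambda>x. measure_pmf.prob (q x) D)"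
proof -
  have "measure_pmf.prob (bind_pmf p q) D
      = enn2real (\<integral>\<^sup>+ x. ennreal (measure_pmf.prob (q x) D) \<partial>measure_pmf p)"
    by (subst measure_def) (simp flip: measure_pmf.emeasure_eq_measure)
  also have "\<dots> = measure_pmf.expectation p (\<lambda>x. measure_pmf.prob (q x) D)"
    by (rule integral_eq_nn_integral[symmetric]) auto
  finally show ?thesis .
qed

lemma prob_replicate_pmf_all:
  "measure_pmf.prob (replicate_pmf k p) {xs. set xs \<subseteq> D} = measure_pmf.prob p D ^ k"
proof (induction k)
  case (Suc k)
  have "replicate_pmf (Suc k) p = bind_pmf p (\<lambda>x. map_pmf ((#) x) (replicate_pmf k p))"
    by (simp add: map_pmf_def)
  moreover have "measure_pmf.prob (map_pmf ((#) x) (replicate_pmf k p)) {xs. set xs \<subseteq> D}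
      = indicator D x * measure_pmf.prob p D ^ k" for x
    using Suc by (cases "x \<in> D") (auto simp: vimage_def)
  ultimately show ?case by (simp add: prob_bind_pmf)
qed simp

text \<open>One sample misses the differences with probability at most \<open>1 - 1 / k\<close>, so
  \<open>k\<close> independent samples all miss with probability at most
  \<open>(1 - 1 / k) ^ k \<le> exp (- 1)\<close>. On \<open>X\<close> itself no check can
  fail.\<close>

lemma rand_verifier_from_hitting_pmf:
  assumes X: "X \<in> inputs n" and p: "set_pmf p \<subseteq> {..<n}" and k: "k \<ge> 1"
    and hit: "\<And>Y. Y \<in> inputs n \<Longrightarrow> f Y \<noteq> f X \<Longrightarrow> 1 / real k \<le> measure_pmf.prob p {i. Y ! i \<noteq> X ! i}"
  obtains A where "is_rand_verifier n f X A" "expected_queries n A \<le> of_nat k"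
proof
  define A where "A = map_pmf (check_positions X) (replicate_pmf k p)"
  have supp: "\<exists>is. T = check_positions X is \<and> length is = k \<and> set is \<subseteq> {..<n}" if "T \<in> set_pmf A" for T
    using that p by (auto simp: A_def set_replicate_pmf)
  show "is_rand_verifier n f X A"
    unfolding is_rand_verifier_def
  proof (intro conjI ballI impI)
    show "query_positions T \<subseteq> {..<n}" if "T \<in> set_pmf A" for T
      using supp[OF that] by (auto simp: query_positions_check_positions)
    show "measure_pmf.prob A {T. accepts T X} = 1"
      by (simp add: A_def accepts_check_positions)
    fix Y assume Y: "Y \<in> inputs n" "f Y \<noteq> f X"
    let ?D = "{i. Y ! i = X ! i}"
    have "measure_pmf.prob p {i. Y ! i \<noteq> X ! i} = 1 - measure_pmf.prob p ?D"
      by (subst measure_pmf.prob_compl[symmetric]) (auto intro: arg_cong[where f = "measure_pmf.prob p"])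
    then have "measure_pmf.prob p ?D \<le> 1 - 1 / k" using hit[OF Y] by simp
    then have "measure_pmf.prob p ?D ^ k \<le> (1 - 1 / k) ^ k" by (intro power_mono) auto
    also have "\<dots> \<le> exp (- (1 / k)) ^ k"
      using k exp_ge_add_one_self[of "- (1 / k)"] by (intro power_mono) auto
    also have "\<dots> = exp (- 1)" using k by (simp flip: exp_of_nat_mult)
    \<comment> \<open>The crude bound \<open>exp 1 \<ge> 1 + 1\<close> suffices.\<close>
    also have "\<dots> \<le> 1 / 2"
      using exp_ge_add_one_self[of 1] by (simp add: exp_minus field_simps)
    finally have "measure_pmf.prob A {T. accepts T Y} \<le> 1 / 2"
      using prob_replicate_pmf_all[of k p ?D]
      by (simp add: A_def accepts_check_positions vimage_def subset_eq)
    moreover have "measure_pmf.prob A {T. \<not> accepts T Y} = 1 - measure_pmf.prob A {T. accepts T Y}"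
      by (subst measure_pmf.prob_compl[symmetric]) (auto intro: arg_cong[where f = "measure_pmf.prob A"])
    ultimately show "1 / 2 \<le> measure_pmf.prob A {T. \<not> accepts T Y}" by simp
  qed
  show "expected_queries n A \<le> of_nat k"
    unfolding expected_queries_def
  proof (rule SUP_least)
    fix Y
    have "(\<integral>\<^sup>+ T. of_nat (num_queries T Y) \<partial>measure_pmf A) \<le> (\<integral>\<^sup>+ T. of_nat k \<partial>measure_pmf A)"
    proof (rule nn_integral_mono_AE)
      have "num_queries T Y \<le> k" if "T \<in> set_pmf A" for T
        using supp[OF that] num_queries_check_positions by metis
      then show "AE T in measure_pmf A. of_nat (num_queries T Y) \<le> (of_nat k :: ennreal)"
        by (auto intro!: AE_pmfI)
    qed
    then show "(\<integral>\<^sup>+ T. of_nat (num_queries T Y) \<partial>measure_pmf A) \<le> of_nat k"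
      by (simp add: measure_pmf.emeasure_space_1)
  qed
qed

section \<open>From bounds on verifiers to bounds on \<open>rand_cert\<close>\<close>

lemma rand_cert_leI:
  assumes "\<And>X. X \<in> inputs n \<Longrightarrow> \<exists>A. is_rand_verifier n f X A \<and> expected_queries n A \<le> of_nat k"
  shows "rand_cert n f \<le> real k"
proof -
  have "rand_cert_at n f X \<le> real k" if X: "X \<in> inputs n" for X
  proof -
    obtain A where "is_rand_verifier n f X A" "expected_queries n A \<le> of_nat k"
      using assms[OF X] by blast
    then have "(INF A\<in>{A. is_rand_verifier n f X A}. expected_queries n A) \<le> of_nat k"
      by (intro INF_lower2[of A]) auto
    then have "rand_cert_at n f X \<le> enn2real (of_nat k)"
      unfolding rand_cert_at_def by (rule enn2real_mono) (simp add: of_nat_less_top)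
    then show ?thesis by simp
  qed
  then show ?thesis
    unfolding rand_cert_def using finite_inputs inputs_nonempty by (subst Max_le_iff) auto
qed

text \<open>The finite upper bound keeps the infimum away from \<open>top\<close>, which \<open>enn2real\<close> maps to 0.\<close>

lemma rand_cert_geI:
  assumes X: "X \<in> inputs n" and c: "0 \<le> c"
    and fin: "\<exists>A. is_rand_verifier n f X A \<and> expected_queries n A \<le> of_nat k"
    and le: "\<And>A. is_rand_verifier n f X A \<Longrightarrow> ennreal c \<le> expected_queries n A"
  shows "c \<le> rand_cert n f"
proof -
  let ?I = "INF A\<in>{A. is_rand_verifier n f X A}. expected_queries n A"
  obtain A where "is_rand_verifier n f X A" "expected_queries n A \<le> of_nat k"
    using fin by blast
  then have "?I \<le> of_nat k" by (intro INF_lower2[of A]) auto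
  then have "?I < top" by (rule le_less_trans) (simp add: of_nat_less_top)
  moreover have "ennreal c \<le> ?I" using le by (intro INF_greatest) auto
  ultimately have "enn2real (ennreal c) \<le> rand_cert_at n f X"
    unfolding rand_cert_at_def by (intro enn2real_mono)
  also have "\<dots> \<le> rand_cert n f"
    unfolding rand_cert_def using X finite_inputs by (intro Max_ge) auto
  finally show ?thesis using c by simp
qed

section \<open>An input with many sensitive bits\<close>

lemma block_list_update:
  assumes "X \<in> inputs (n * m)" "i < n" "j < m" "i' < n"
  shows "block m i' (X[i * m + j := v]) = (if i' = i then (block m i X)[j := v] else block m i' X)"
proof (rule nth_equalityI)
  let ?X = "X[i * m + j := v]"
  have X': "?X \<in> inputs (n * m)" using assms by (simp add: inputs_def)
  have len: "length (block m i' ?X) = m" "length (block m i X) = m" "length (block m i' X) = m"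
    using block_in_inputs[OF X'] block_in_inputs[OF assms(1)] assms by (auto simp: inputs_def)
  then show "length (block m i' ?X) = length (if i' = i then (block m i X)[j := v] else block m i' X)"
    by simp
  fix k assume "k < length (block m i' ?X)"
  then have k: "k < m" using len by simp
  \<comment> \<open>Uniqueness of quotient and remainder modulo \<open>m\<close>.\<close>
  have inj: "i' * m + k = i * m + j \<longleftrightarrow> i' = i \<and> k = j"
  proof
    assume eq: "i' * m + k = i * m + j"
    have "i' = (i' * m + k) div m" "i = (i * m + j) div m" using k assms(3) by auto
    with eq have "i' = i" by simp
    then show "i' = i \<and> k = j" using eq by simp
  qed simp
  show "block m i' ?X ! k = (if i' = i then (block m i X)[j := v] else block m i' X) ! k"
    using nth_block[OF X' assms(4) k] nth_block[OF assms(1,4) k] nth_block[OF assms(1,2) k] inj len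
      block_index[OF assms(2,3)] assms(1,3)
    by (cases "i' = i \<and> k = j") (auto simp: nth_list_update inputs_def)
qed

text \<open>With 17 copies of a sensitive input of value 0 and 12 blocks of value 1, the count is
  12, just below the accepted range. A sensitive bit flipped in any one of the 17 copies raises it
  to 13.\<close>

lemma iter_g1_sensitive_input:
  "\<exists>X K. X \<in> inputs (29 ^ t) \<and> \<not> iter_g1 t X \<and> K \<subseteq> {..<29 ^ t} \<and> card K = 17 ^ t \<and>
     (\<forall>i\<in>K. iter_g1 t (X[i := \<not> X ! i]))"
proof (induction t)
  case 0
  show ?case by (intro exI[of _ "[False]"] exI[of _ "{0}"]) (auto simp: inputs_def)
next
  case (Suc t)
  let ?m = "29 ^ t :: nat"
  obtain X0 K0 where X0: "X0 \<in> inputs ?m" "\<not> iter_g1 t X0" and K0: "K0 \<subseteq> {..<?m}" "card K0 = 17 ^ t"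
    and sens: "\<And>i. i \<in> K0 \<Longrightarrow> iter_g1 t (X0[i := \<not> X0 ! i])"
    using Suc.IH by blast
  have finK0: "finite K0" using K0 finite_subset by blast
  \<comment> \<open>Flipping any one sensitive bit of \<open>X0\<close> supplies the block of value
    1; there is such a bit because \<open>17 ^ t\<close> is positive.\<close>
  have "K0 \<noteq> {}" using K0 by auto
  then obtain j0 where "j0 \<in> K0" by blast
  define X1 where "X1 = X0[j0 := \<not> X0 ! j0]"
  have X1: "X1 \<in> inputs ?m" "iter_g1 t X1"
    using X0 sens[OF \<open>j0 \<in> K0\<close>] by (auto simp: X1_def inputs_def)
  define B where "B i = (if i < 17 then X0 else X1)" for i :: nat
  define X where "X = join_blocks ?m 29 B"
  define K where "K = (\<lambda>(i, j). i * ?m + j) ` ({..<17} \<times> K0)"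
  have X: "X \<in> inputs (29 * ?m)" by (simp only: X_def join_blocks_in_inputs)
  have B: "B i \<in> inputs ?m" for i by (simp add: B_def X0 X1)
  have blk: "block ?m i X = B i" if "i < 29" for i
    unfolding X_def using that B by (rule block_join_blocks)
  have "{i. i < 29 \<and> iter_g1 t (B i)} = {17..<29}"
    using X0 X1 by (auto simp: B_def)
  then have "\<not> iter_g1 (Suc t) X"
    unfolding X_def using iter_g1_join_blocks[of B t] B by simp
  moreover have "K \<subseteq> {..<29 ^ Suc t}"
  proof
    fix k assume "k \<in> K"
    then obtain i j where "k = i * ?m + j" "i < 17" "j \<in> K0" by (auto simp: K_def)
    then show "k \<in> {..<29 ^ Suc t}" using block_index[of i 29 j ?m] K0 by auto
  qed
  moreover have "card K = 17 ^ Suc t"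
  proof -
    have "inj_on (\<lambda>(i, j). i * ?m + j) ({..<17} \<times> K0)"
    proof (rule inj_onI, clarify)
      fix i j i' j' assume eq: "i * ?m + j = i' * ?m + j'" and "j \<in> K0" "j' \<in> K0"
      then have "j < ?m" "j' < ?m" using K0 by auto
      then have "(i * ?m + j) div ?m = i" "(i' * ?m + j') div ?m = i'" by simp_all
      then have "i = i'" by (simp only: eq)
      then show "i = i' \<and> j = j'" using eq by simp
    qed
    then show ?thesis by (simp add: K_def card_image card_cartesian_product K0)
  qed
  moreover have "iter_g1 (Suc t) (X[k := \<not> X ! k])" if kK: "k \<in> K" for k
  proof -
    obtain i j where k: "k = i * ?m + j" and i: "i < 17" and j: "j \<in> K0" "j < ?m"
      using kK K0 by (auto simp: K_def)
    have i29: "i < 29" using i by simp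
    have "X ! k = B i ! j"
      using nth_join_blocks[OF i29 j(2), of B] by (simp add: X_def k)
    then have Xk: "X ! k = X0 ! j" using i by (simp add: B_def)
    have "block ?m i' (X[k := \<not> X ! k]) = (if i' = i then X0[j := \<not> X0 ! j] else B i')"
      if "i' < 29" for i'
      unfolding Xk unfolding k block_list_update[OF X i29 j(2) that]
      using blk[OF i29] blk[OF that] i by (simp add: B_def)
    then have "{i'. i' < 29 \<and> iter_g1 t (block ?m i' (X[k := \<not> X ! k]))} = insert i {17..<29}"
      using sens[OF j(1)] X0 X1 i by (auto simp: B_def split: if_splits)
    moreover have "card (insert i {17..<29}) = 13" using i by simp
    ultimately show ?thesis by (simp add: iter_g1_Suc)
  qed
  moreover have "X \<in> inputs (29 ^ Suc t)" using X by simp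
  ultimately show ?case by blast
qed

section \<open>Distributions that hit the differences between two inputs\<close>

text \<open>\<open>A\<close> and \<open>B\<close> stand for the sets of ones of two inputs. If
  \<open>A\<close> has value 0, it has 17 equal bits; a \<open>B\<close> of value 1 has at most 16
  ones and at most 16 zeros, so it differs on one of them, and the uniform distribution on them
  works. If \<open>A\<close> has value 1, uniform choices among its ones and among its zeros are
  mixed.\<close>

lemma g1_hitting_pmf:
  fixes A :: "nat set"
  assumes A: "A \<subseteq> {..<29}"
  shows "\<exists>p. set_pmf p \<subseteq> {..<29} \<and> (\<forall>B\<subseteq>{..<29}. (card A \<in> {13..16}) \<noteq> (card B \<in> {13..16}) \<longrightarrow>
           1 / 17 \<le> measure_pmf.prob p {i. (i \<in> A) \<noteq> (i \<in> B)})"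
proof -
  have finA: "finite A" using A finite_subset by blast
  have "card A \<le> 29" using card_mono[OF _ A] by simp
  then have cardA: "card A + card ({..<29} - A) = 29"
    using A finA by (simp add: card_Diff_subset)
  have uniform: ?thesis
    if U: "U \<subseteq> {..<29}" "card U = 17" and hit: "\<And>B. B \<subseteq> {..<29} \<Longrightarrow> 
        (card A \<in> {13..16}) \<noteq> (card B \<in> {13..16}) \<Longrightarrow> \<exists>i\<in>U. (i \<in> A) \<noteq> (i \<in> B)" for U
  proof (intro exI[of _ "pmf_of_set U"] conjI allI impI)
    have finU: "finite U" "U \<noteq> {}" using U finite_subset by auto
    show "set_pmf (pmf_of_set U) \<subseteq> {..<29}" using U finU by simp
    fix B assume "B \<subseteq> {..<29::nat}" "(card A \<in> {13..16}) \<noteq> (card B \<in> {13..16})"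
    then have "U \<inter> {i. (i \<in> A) \<noteq> (i \<in> B)} \<noteq> {}" using hit by blast
    then have "1 \<le> card (U \<inter> {i. (i \<in> A) \<noteq> (i \<in> B)})"
      using finU by (simp add: Suc_le_eq card_gt_0_iff)
    then show "1 / 17 \<le> measure_pmf.prob (pmf_of_set U) {i. (i \<in> A) \<noteq> (i \<in> B)}"
      using finU U by (simp add: measure_pmf_of_set)
  qed
  consider (low) "card A \<le> 12" | (high) "17 \<le> card A" | (mid) "card A \<in> {13..16}" by fastforce
  then show ?thesis
  proof cases
    case low
    then have "17 \<le> card ({..<29} - A)" using cardA by simp
    then obtain U where U: "U \<subseteq> {..<29} - A" "card U = 17" "finite U"
      by (rule obtain_subset_with_card_n)
    show ?thesis
    proof (rule uniform[of U])
      fix B assume B: "B \<subseteq> {..<29::nat}" "(card A \<in> {13..16}) \<noteq> (card B \<in> {13..16})"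
      show "\<exists>i\<in>U. (i \<in> A) \<noteq> (i \<in> B)"
      proof (rule ccontr)
        assume "\<not> ?thesis"
        then have "B \<subseteq> {..<29} - U" using U B by blast
        then have "card B \<le> card ({..<29} - U)" by (intro card_mono) auto
        also have "\<dots> = 12" using U by (subst card_Diff_subset) auto
        finally show False using B low by auto
      qed
    qed (use U in auto)
  next
    case high
    then have "17 \<le> card A" by simp
    then obtain U where U: "U \<subseteq> A" "card U = 17" "finite U"
      by (rule obtain_subset_with_card_n)
    show ?thesis
    proof (rule uniform[of U])
      fix B assume B: "B \<subseteq> {..<29::nat}" "(card A \<in> {13..16}) \<noteq> (card B \<in> {13..16})"
      show "\<exists>i\<in>U. (i \<in> A) \<noteq> (i \<in> B)"
      proof (rule ccontr)
        assume "\<not> ?thesis"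
        then have "U \<subseteq> B" using U B by blast
        then have "card U \<le> card B" using B finite_subset by (intro card_mono) auto
        then show False using B high U by auto
      qed
    qed (use U A in auto)
  next
    case mid
    let ?A' = "{..<29} - A"
    txt \<open>Changing the value takes \<open>card A - 12\<close> deletions or \<open>17 - card A\<close> insertions; the weight
      \<open>\<alpha>\<close> of \<open>A\<close> makes both detectable with probability \<open>1 / 17\<close>.\<close>
    define \<alpha> :: real where "\<alpha> = (if card A = 13 then 13 / 17 else if card A = 16 then 4 / 17 else 1 / 2)"
    define p where "p = bind_pmf (bernoulli_pmf \<alpha>) (\<lambda>b. pmf_of_set (if b then A else ?A'))"
    have "card A \<noteq> 0" "card ?A' \<noteq> 0" using mid cardA by (simp_all del: card_0_eq)
    then have ne: "A \<noteq> {}" "?A' \<noteq> {}" by (metis card.empty)+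
    have \<alpha>: "0 \<le> \<alpha>" "\<alpha> \<le> 1" by (auto simp: \<alpha>_def)
    have "1 / 17 \<le> measure_pmf.prob p {i. (i \<in> A) \<noteq> (i \<in> B)}"
      if B: "B \<subseteq> {..<29}" "(card A \<in> {13..16}) \<noteq> (card B \<in> {13..16})" for B
    proof -
      have finB: "finite B" using B finite_subset by blast
      \<comment> \<open>Written with \<open>=\<close> and \<open>\<notin>\<close>, the form into
        which simplification brings the disagreement.\<close>
      have *: "A \<inter> {i. (i \<in> A) = (i \<notin> B)} = A - B" "?A' \<inter> {i. (i \<in> A) = (i \<notin> B)} = B - A"
        using A B by auto
      have prob: "measure_pmf.prob p {i. (i \<in> A) \<noteq> (i \<in> B)}
          = card (A - B) / card A * \<alpha> + card (B - A) / card ?A' * (1 - \<alpha>)"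
        using \<alpha> ne finA by (simp add: p_def prob_bind_pmf measure_pmf_of_set *)
      have "card (A - B) + card (A \<inter> B) = card A" "card (B - A) + card (A \<inter> B) = card B"
        using card_Diff_subset_Int[of A B] card_Diff_subset_Int[of B A] finA finB
          card_mono[of A "A \<inter> B"] card_mono[of B "A \<inter> B"] by (auto simp: Int_commute)
      \<comment> \<open>Either \<open>B\<close> has at most 12 elements and lost at least
        \<open>card A - 12\<close>, or it has at least 17 and gained at least
        \<open>17 - card A\<close>.\<close>
      then have "card A \<le> card (A - B) + 12 \<or> 17 \<le> card (B - A) + card A" using B mid by auto
      then have "real (card A) - 12 \<le> card (A - B) \<or> 17 - real (card A) \<le> card (B - A)" by linarith
      \<comment> \<open>For exactly \<open>card A - 12\<close> deletions, sizes 13 and 16 meet the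
        bound with equality, as \<open>1 / 13 * (13 / 17)\<close> and
        \<open>4 / 16 * (4 / 17)\<close>; sizes 14 and 15 leave slack.\<close>
      moreover have "1 / 17 \<le> card (A - B) / card A * \<alpha>" if "real (card A) - 12 \<le> card (A - B)"
        using mid that by (auto simp: \<alpha>_def field_simps)
      moreover have "1 / 17 \<le> card (B - A) / card ?A' * (1 - \<alpha>)" if "17 - real (card A) \<le> card (B - A)"
      proof -
        have "card ?A' = 29 - card A" using cardA by simp
        moreover have "card A = 13 \<or> card A = 14 \<or> card A = 15 \<or> card A = 16" using mid by auto
        ultimately show ?thesis using that by (auto simp: \<alpha>_def field_simps)
      qed
      moreover have "0 \<le> card (A - B) / card A * \<alpha>" "0 \<le> card (B - A) / card ?A' * (1 - \<alpha>)"
        using \<alpha> by auto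
      ultimately show ?thesis unfolding prob by linarith
    qed
    moreover have "set_pmf p \<subseteq> {..<29}"
      using ne finA A by (auto simp: p_def split: if_splits)
    ultimately show ?thesis by blast
  qed
qed

text \<open>If the outer values differ, the block drawn by \<open>p\<close> changes its value with
  probability at least \<open>1 / 17\<close>, and in each such block \<open>q i\<close> finds a
  differing bit with probability at least \<open>1 / 17 ^ t\<close>. The bounds multiply.\<close>

lemma iter_g1_hitting_pmf:
  assumes "X \<in> inputs (29 ^ t)"
  shows "\<exists>p. set_pmf p \<subseteq> {..<29 ^ t} \<and> (\<forall>Y\<in>inputs (29 ^ t). iter_g1 t Y \<noteq> iter_g1 t X \<longrightarrow>
           1 / 17 ^ t \<le> measure_pmf.prob p {i. Y ! i \<noteq> X ! i})"
  using assms
proof (induction t arbitrary: X)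
  case 0
  show ?case by (intro exI[of _ "return_pmf 0"]) auto
next
  case (Suc t)
  let ?m = "29 ^ t :: nat"
  have X: "X \<in> inputs (29 * ?m)" using Suc.prems by simp
  let ?A = "\<lambda>Y. {i. i < 29 \<and> iter_g1 t (block ?m i Y)}"
  obtain p where p: "set_pmf p \<subseteq> {..<29}"
    and p_hit: "\<And>B. B \<subseteq> {..<29} \<Longrightarrow> (card (?A X) \<in> {13..16}) \<noteq> (card B \<in> {13..16}) \<Longrightarrow>
           1 / 17 \<le> measure_pmf.prob p {i. (i \<in> ?A X) \<noteq> (i \<in> B)}"
    using g1_hitting_pmf[of "?A X"] by auto
  \<comment> \<open>One predicate for both properties allows a single choice of \<open>q\<close> for
    all blocks.\<close>
  define ok where "ok i q \<longleftrightarrow> set_pmf q \<subseteq> {..<?m} \<and>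
      (\<forall>Z\<in>inputs ?m. iter_g1 t Z \<noteq> iter_g1 t (block ?m i X) \<longrightarrow>
         1 / 17 ^ t \<le> measure_pmf.prob q {j. Z ! j \<noteq> block ?m i X ! j})" for i q
  have "\<exists>q. ok i q" if "i < 29" for i
    unfolding ok_def by (rule Suc.IH[OF block_in_inputs[OF X that]])
  then obtain q where "\<And>i. i < 29 \<Longrightarrow> ok i (q i)" by metis
  then have q: "\<And>i. i < 29 \<Longrightarrow> set_pmf (q i) \<subseteq> {..<?m}"
    and q_hit: "\<And>i Z. i < 29 \<Longrightarrow> Z \<in> inputs ?m \<Longrightarrow> iter_g1 t Z \<noteq> iter_g1 t (block ?m i X) \<Longrightarrow>
           1 / 17 ^ t \<le> measure_pmf.prob (q i) {j. Z ! j \<noteq> block ?m i X ! j}"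
    unfolding ok_def by blast+
  define r where "r = bind_pmf p (\<lambda>i. map_pmf (\<lambda>j. i * ?m + j) (q i))"
  have "set_pmf r \<subseteq> {..<29 ^ Suc t}"
  proof
    fix k assume "k \<in> set_pmf r"
    then obtain i j where k: "i \<in> set_pmf p" "j \<in> set_pmf (q i)" "k = i * ?m + j"
      by (auto simp: r_def)
    then have "i < 29" using p by auto
    moreover from this have "j < ?m" using q k by auto
    ultimately show "k \<in> {..<29 ^ Suc t}" using block_index[of i 29 j ?m] k(3) by simp
  qed
  moreover have "1 / 17 ^ Suc t \<le> measure_pmf.prob r {k. Y ! k \<noteq> X ! k}"
    if "Y \<in> inputs (29 ^ Suc t)" and neq: "iter_g1 (Suc t) Y \<noteq> iter_g1 (Suc t) X" for Y
  proof -
    have Y: "Y \<in> inputs (29 * ?m)" using that by simp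
    let ?D = "{i. (i \<in> ?A X) \<noteq> (i \<in> ?A Y)}"
    let ?P = "\<lambda>i. measure_pmf.prob (q i) {j. Y ! (i * ?m + j) \<noteq> X ! (i * ?m + j)}"
    have "(card (?A X) \<in> {13..16}) \<noteq> (card (?A Y) \<in> {13..16})"
      using neq unfolding iter_g1_Suc by blast
    then have D: "1 / 17 \<le> measure_pmf.prob p ?D" by (intro p_hit) auto
    have P: "1 / 17 ^ t \<le> ?P i" if i: "i \<in> ?D" for i
    proof -
      have i29: "i < 29" using i by auto
      have "1 / 17 ^ t \<le> measure_pmf.prob (q i) {j. block ?m i Y ! j \<noteq> block ?m i X ! j}"
        using i by (intro q_hit[OF i29] block_in_inputs[OF Y i29]) auto
      also have "\<dots> \<le> ?P i"
      \<comment> \<open>\<open>nth_block\<close> covers only offsets below \<open>29 ^ t\<close>, so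
        the inclusion is shown on the support of \<open>q i\<close>.\<close>
      proof (rule measure_pmf.finite_measure_mono_AE)
        show "AE j in measure_pmf (q i). j \<in> {j. block ?m i Y ! j \<noteq> block ?m i X ! j} \<longrightarrow>
            j \<in> {j. Y ! (i * ?m + j) \<noteq> X ! (i * ?m + j)}"
          using q[OF i29] nth_block[OF X i29] nth_block[OF Y i29] by (intro AE_pmfI) auto
      qed simp
      finally show ?thesis .
    qed
    have "1 / 17 ^ Suc t \<le> measure_pmf.prob p ?D * (1 / 17 ^ t)"
      using D mult_right_mono[of "1 / 17" "measure_pmf.prob p ?D" "1 / 17 ^ t"] by simp
    also have "\<dots> = measure_pmf.expectation p (\<lambda>i. indicator ?D i * (1 / 17 ^ t))"
      by simp
    also have "\<dots> \<le> measure_pmf.expectation p ?P"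
    proof (rule integral_mono)
      show "integrable (measure_pmf p) (\<lambda>i. indicator ?D i * (1 / 17 ^ t) :: real)"
        by (intro integrable_mult_left integrable_real_indicator) (auto simp: measure_pmf.emeasure_eq_measure)
      show "integrable (measure_pmf p) ?P"
        by (rule measure_pmf.integrable_const_bound[where B = 1]) auto
      show "indicator ?D i * (1 / 17 ^ t) \<le> ?P i" for i
        using P[of i] by (cases "i \<in> ?D") auto
    qed
    also have "\<dots> = measure_pmf.prob r {k. Y ! k \<noteq> X ! k}"
      by (simp add: r_def prob_bind_pmf vimage_def)
    finally show ?thesis .
  qed
  ultimately show ?case by blast
qed

lemma rand_cert_iter_g1_bounds:
  shows "17 ^ t / 2 \<le> rand_cert (29 ^ t) (iter_g1 t)" "rand_cert (29 ^ t) (iter_g1 t) \<le> 17 ^ t"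
proof -
  have verifier: "\<exists>A. is_rand_verifier (29 ^ t) (iter_g1 t) X A \<and>
      expected_queries (29 ^ t) A \<le> of_nat (17 ^ t)" if X: "X \<in> inputs (29 ^ t)" for X
  proof -
    obtain p where p: "set_pmf p \<subseteq> {..<29 ^ t}"
      "\<And>Y. Y \<in> inputs (29 ^ t) \<Longrightarrow> iter_g1 t Y \<noteq> iter_g1 t X \<Longrightarrow>
         1 / 17 ^ t \<le> measure_pmf.prob p {i. Y ! i \<noteq> X ! i}"
      using iter_g1_hitting_pmf[OF X] by blast
    show ?thesis
      by (rule rand_verifier_from_hitting_pmf[OF X p(1), of "17 ^ t" "iter_g1 t"]) (use p(2) in auto)
  qed
  from rand_cert_leI[OF this] show "rand_cert (29 ^ t) (iter_g1 t) \<le> 17 ^ t" by simp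
  obtain X K where X: "X \<in> inputs (29 ^ t)" "\<not> iter_g1 t X" and K: "K \<subseteq> {..<29 ^ t}" "card K = 17 ^ t"
    and sens: "\<And>i. i \<in> K \<Longrightarrow> iter_g1 t (X[i := \<not> X ! i])"
    using iter_g1_sensitive_input[of t] by blast
  show "17 ^ t / 2 \<le> rand_cert (29 ^ t) (iter_g1 t)"
  \<comment> \<open>The verifier of the upper bound supplies the finite bound required here.\<close>
  proof (rule rand_cert_geI[OF X(1) _ verifier[OF X(1)]])
    fix A assume A: "is_rand_verifier (29 ^ t) (iter_g1 t) X A"
    show "ennreal (17 ^ t / 2) \<le> expected_queries (29 ^ t) A"
      using expected_queries_ge[OF A X(1) K(1)] sens X(2) K(2) by simp
  qed simp
qed

section \<open>The exponent\<close>

theorem proposition12: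
  "\<exists>c::real. \<bar>c - 0.907\<bar> < 0.0005 \<and>
     (\<lambda>t. rand_cert (29 ^ t) (g t)) \<in> \<Theta>(\<lambda>t. real (cert (29 ^ t) (g t)) powr c)"
proof (intro exI conjI)
  define r :: real where "r = (13 + sqrt 1053) / 2"
  \<comment> \<open>The exponent with \<open>r powr ?c = 17\<close>.\<close>
  let ?c = "ln 17 / ln r"
  \<comment> \<open>This precision is enough for the comparisons \<open>r ^ 39 < 17 ^ 43\<close> and
    \<open>17 ^ 54 < r ^ 49\<close> below.\<close>
  have "32.44 \<le> sqrt 1053" by (intro real_le_rsqrt) (simp add: power2_eq_square)
  moreover have "sqrt 1053 \<le> 32.46" by (intro real_le_lsqrt) (simp_all add: power2_eq_square)
  ultimately have r: "22.72 \<le> r" "r \<le> 22.73" by (auto simp: r_def)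
  then have ln_r: "0 < ln r" by simp
  txt \<open>\<open>39 / 43\<close> and \<open>49 / 54\<close> are the convenient fractions around \<open>ln 17 / ln r = 0.90707\<dots>\<close>.\<close>
  have "39 * ln r = ln (r ^ 39)" using r by (simp add: ln_realpow)
  also have "\<dots> < ln (17 ^ 43)"
  proof -
    have "r ^ 39 \<le> 22.73 ^ 39" using r by (intro power_mono) auto
    also have "(22.73 :: real) ^ 39 < 17 ^ 43" by (simp add: power_divide)
    finally show ?thesis using r by simp
  qed
  also have "\<dots> = 43 * ln 17" by (subst ln_realpow) simp_all
  finally have lower: "39 / 43 < ?c" using ln_r by (simp add: field_simps)
  have "54 * ln 17 = ln (17 ^ 54 :: real)" by (subst ln_realpow) simp_all
  also have "\<dots> < ln (r ^ 49)"
  proof -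
    have "(17 :: real) ^ 54 < 22.72 ^ 49" by (simp add: power_divide)
    also have "\<dots> \<le> r ^ 49" using r by (intro power_mono) auto
    finally show ?thesis using r by simp
  qed
  also have "\<dots> = 49 * ln r" using r by (simp add: ln_realpow)
  finally have upper: "?c < 49 / 54" using ln_r by (simp add: field_simps)
  have "\<bar>c - 0.907\<bar> < 0.0005" if "39 / 43 < c" "c < 49 / 54" for c :: real
    using that by (intro abs_less_iff[THEN iffD2] conjI) (simp_all add: field_simps)
  from this[OF lower upper] show "\<bar>?c - 0.907\<bar> < 0.0005" .

  let ?C = "\<lambda>t. real (cert (29 ^ t) (g t)) powr ?c"
  let ?M = "(r / 17) powr ?c"
  have c0: "0 \<le> ?c" using ln_r by simp
  have rpow: "(r ^ t) powr ?c = 17 ^ t" for t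
  proof -
    have "(r ^ t) powr ?c = (r powr real t) powr ?c" using r by (simp add: powr_realpow)
    also have "\<dots> = (r powr ?c) powr real t" by (simp only: powr_powr mult.commute)
    also have "r powr ?c = 17" using r ln_r by (simp add: powr_def)
    also have "17 powr real t = 17 ^ t" by (simp add: powr_realpow)
    finally show ?thesis .
  qed
  \<comment> \<open>\<open>g 0\<close> is a dummy, so the bounds start at \<open>t = 1\<close>,
    which suffices for an asymptotic statement.\<close>
  have g: "cert (29 ^ t) (g t) = cert_rec True t"
    "rand_cert (29 ^ t) (g t) = rand_cert (29 ^ t) (iter_g1 t)" if "t \<ge> 1" for t
  proof -
    have "g t x = iter_g1 t x" if "x \<in> inputs (29 ^ t)" for x
      using g_eq_iter_g1[of x "t - 1"] \<open>t \<ge> 1\<close> that by simp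
    then show "cert (29 ^ t) (g t) = cert_rec True t"
      "rand_cert (29 ^ t) (g t) = rand_cert (29 ^ t) (iter_g1 t)"
      using cert_cong rand_cert_cong cert_iter_g1 by metis+
  qed
  \<comment> \<open>Raising to the power \<open>?c\<close> is monotone and turns
    \<open>r ^ t\<close> into \<open>17 ^ t\<close> and the factor \<open>r / 17\<close> into
    \<open>?M\<close>.\<close>
  have C: "17 ^ t \<le> ?C t" "?C t \<le> ?M * 17 ^ t" if "t \<ge> 1" for t
  proof -
    have "(r ^ t) powr ?c \<le> ?C t"
      using cert_rec_bounds(1)[OF r_def, of t] r c0 by (intro powr_mono2) (auto simp: g[OF that])
    then show "17 ^ t \<le> ?C t" by (simp only: rpow)
    have "?C t \<le> (r / 17 * r ^ t) powr ?c"
      using cert_rec_bounds(2)[OF r_def, of t] c0 by (intro powr_mono2) (auto simp: g[OF that])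
    also have "\<dots> = ?M * (r ^ t) powr ?c" by (rule powr_mult)
    finally show "?C t \<le> ?M * 17 ^ t" by (simp only: rpow)
  qed
  have M: "0 < ?M" using r by simp
  show "(\<lambda>t. rand_cert (29 ^ t) (g t)) \<in> \<Theta>(?C)"
  proof (rule bigthetaI)
    \<comment> \<open>Constant 1 works because \<open>17 ^ t\<close> separates the two
      sides.\<close>
    have "\<bar>rand_cert (29 ^ t) (g t)\<bar> \<le> 1 * \<bar>?C t\<bar>" if "t \<ge> 1" for t
    proof -
      have "0 \<le> rand_cert (29 ^ t) (iter_g1 t)"
        by (rule order_trans[OF _ rand_cert_iter_g1_bounds(1)]) simp
      then show ?thesis
        using C(1)[OF that] rand_cert_iter_g1_bounds(2)[of t] by (simp add: g[OF that])
    qed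
    then show "(\<lambda>t. rand_cert (29 ^ t) (g t)) \<in> O(?C)"
      by (intro bigoI[of _ 1] eventually_mono[OF eventually_ge_at_top[of 1]]) (simp only: real_norm_def)
    \<comment> \<open>The constant combines the factor \<open>1 / 2\<close> lost for
      \<open>rand_cert\<close> with the factor \<open>?M\<close> lost for
      \<open>cert\<close>.\<close>
    have "1 / (2 * ?M) * \<bar>?C t\<bar> \<le> \<bar>rand_cert (29 ^ t) (g t)\<bar>" if "t \<ge> 1" for t
    proof -
      have "1 / (2 * ?M) * \<bar>?C t\<bar> \<le> 1 / (2 * ?M) * (?M * 17 ^ t)"
        using C(2)[OF that] M by (intro mult_left_mono) auto
      also have "\<dots> = 17 ^ t / 2" using M by simp
      also have "\<dots> \<le> \<bar>rand_cert (29 ^ t) (g t)\<bar>"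
        using rand_cert_iter_g1_bounds(1)[of t] by (simp add: g[OF that])
      finally show ?thesis .
    qed
    then show "(\<lambda>t. rand_cert (29 ^ t) (g t)) \<in> \<Omega>(?C)"
      using M by (intro landau_omega.bigI[of "1 / (2 * ?M)"] eventually_mono[OF eventually_ge_at_top[of 1]])
         (simp_all only: real_norm_def zero_less_divide_iff zero_less_mult_iff zero_less_numeral zero_less_one simp_thms)
  qed
qed

end
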